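(* Let $V$ be a finite set with a total order $\prec$ and let $\mathcal{L}$ be an independent hypergraph with its vertices in $V$. Let $t,s\geq 0$ be integers and let $m\in \mathbb{Z}$. Suppose $m=\lambda(2t+1)+q$ where $\lambda\in \mathbb{Z}$ and $0\leq q\leq 2t$. Then: (i) for any $\omega\in \mathrm{Ext}^{2t+1}(V)$, the graded vector space $$C_{(n+\lambda)(2t+1)+q}(\mathcal{L};\mathbb{R}),\qquad n\geq 0,$$ equipped with the co-boundary map $\omega$ gives a sub-co-chain complex of $C^*(\Delta[V],\omega,m)$, denoted $C^*(\mathcal{L},\omega,m)$; (ii) for any $\omega\in \mathrm{Ext}^{2t+1}(V)$ and any $\mu\in \mathrm{Ext}^{2s}(V)$, there is an induced co-chain map $$\mu:\ C^*(\mathcal{L},\omega,m)\longrightarrow C^*(\mathcal{L},\omega,m+2s).$$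
   Context: For $n\ge 0$, $\Lambda_n(V)$ is the real vector space with basis the elementary $n$-paths on $V$, i.e. all ordered sequences $v_0v_1\ldots v_n$ of $n+1$ vertices of $V$ (repetitions allowed, no order condition); $\Lambda_k(V)=0$ for $k<0$. For $v\in V$, the linear map $\frac{\partial}{\partial v}:\Lambda_n(V)\to\Lambda_{n-1}(V)$ is given by $\frac{\partial}{\partial v}(v_0\ldots v_n)=\sum_{i=0}^n(-1)^i\delta(v,v_i)\,v_0\ldots\widehat{v_i}\ldots v_n$ (with $\delta(u,v)=1$ if $u=v$, and $0$ otherwise), and $dv:\Lambda_n(V)\to\Lambda_{n+1}(V)$ ($n\ge 0$) is its adjoint with respect to the inner products for which the elementary paths are orthonormal; explicitly $dv(u_0\ldots u_n)=\sum_{i=0}^{n+1}(-1)^iu_0\ldots u_{i-1}\,v\,u_i\ldots u_n$. One has $du\circ dv=-dv\circ du$. $\mathrm{Ext}^*(V)=\bigoplus_{k\ge0}\mathrm{Ext}^k(V)$ is the real exterior algebra generated by the $dv$, $v\in V$ ($\mathrm{Ext}^0(V)=\mathbb{R}$ acts by scalars), with product $\wedge$ the composition of linear maps, so an element of $\mathrm{Ext}^k(V)$ acts as linear maps $\Lambda_n(V)\to\Lambda_{n+k}(V)$ (zero on $\Lambda_n(V)=0$ for $n<0$). An $n$-hyperedge on $V$ is a sequence $v_0v_1\ldots v_n$ of vertices with $v_0\prec v_1\prec\cdots\prec v_n$, identified with the set $\{v_0,\ldots,v_n\}$; the complete hypergraph $\Delta[V]$ is the set of all hyperedges on $V$. An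 independent hypergraph $\mathcal{L}$ with vertices in $V$ is a set of hyperedges on $V$ such that if $\sigma\in\mathcal{L}$ and $\tau$ is a hyperedge on $V$ with $\sigma\subseteq\tau$, then $\tau\in\mathcal{L}$. $C_n(\mathcal{L};\mathbb{R})$ (resp. $C_n(\Delta[V];\mathbb{R})$) is the real vector space of linear combinations of the $n$-hyperedges in $\mathcal{L}$ (resp. of all $n$-hyperedges on $V$); it is $0$ for $n<0$. An elementary $n$-path $v_0\ldots v_n$ is non-simplicial if $v_j\prec v_i$ or $v_j=v_i$ for some $i<j$; $\mathcal{O}_n(V)\subseteq\Lambda_n(V)$ is the span of these, and canonically $C_n(\Delta[V];\mathbb{R})\cong\Lambda_n(V)/\mathcal{O}_n(V)$. Elements of $\mathrm{Ext}^*(V)$ act on $C_*(\Delta[V];\mathbb{R})$ modulo $\mathcal{O}_*(V)$, i.e. by applying the map on $\Lambda_*(V)$ and then projecting to $C_*(\Delta[V];\mathbb{R})$ by killing non-simplicial elementary paths. Given $t\ge0$, each integer $m$ is written uniquely as $m=\lambda(2t+1)+q$ with $\lambda\in\mathbb{Z}$, $0\le q\le 2t$. For $\omega\in\mathrm{Ext}^{2t+1}(V)$, $C^*(\Delta[V],\omega,m)$ is the co-chain complex with degree-$n$ term $C_{(n+\lambda)(2t+1)+q}(\Delta[V];\mathbb{R})$, $n\ge0$, and co-boundary map $\omega$; it is the quotient of the co-chain complex $\{\Lambda_{(n+\lambda)(2t+1)+q}(V),\omega\}_{n\ge0}$ by its sub-co-chain complex $\{\mathcal{O}_{(n+\lambda)(2t+1)+q}(V),\omega\}_{n\ge0}$.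 *)

theory Defs
  imports "HOL-Analysis.Finite_Function_Topology"
begin

section \<open>Paths on a vertex set\<close>

text \<open>Real chains are finitely supported functions on lists of vertices. An elementary
  \<open>n\<close>-path is a list of length \<open>n + 1\<close>; the degree \<open>n\<close> is an integer, and the empty list is
  not a path, so that there is nothing in negative degrees.\<close>

definition elementary_paths :: "'v set \<Rightarrow> int \<Rightarrow> 'v list set" where
  "elementary_paths V n = {p. p \<noteq> [] \<and> set p \<subseteq> V \<and> int (length p) = n + 1}"

definition chain_span :: "'a set \<Rightarrow> ('a \<Rightarrow>\<^sub>0 real) set" where
  "chain_span P = span ((\<lambda>p. Poly_Mapping.single p 1) ` P)"

definition path_space :: "'v set \<Rightarrow> int \<Rightarrow> ('v list \<Rightarrow>\<^sub>0 real) set" where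
  "path_space V n = chain_span (elementary_paths V n)"

definition lin_extend :: "('a \<Rightarrow> 'b \<Rightarrow>\<^sub>0 real) \<Rightarrow> ('a \<Rightarrow>\<^sub>0 real) \<Rightarrow> 'b \<Rightarrow>\<^sub>0 real" where
  "lin_extend f x = (\<Sum>p\<in>Poly_Mapping.keys x. Poly_Mapping.lookup x p *\<^sub>R f p)"

definition path_inner :: "('a \<Rightarrow>\<^sub>0 real) \<Rightarrow> ('a \<Rightarrow>\<^sub>0 real) \<Rightarrow> real" where
  "path_inner x y = (\<Sum>p\<in>Poly_Mapping.keys x. Poly_Mapping.lookup x p * Poly_Mapping.lookup y p)"

text \<open>The operator \<open>\<partial>/\<partial>v\<close>; a path with a single vertex is sent to \<open>0\<close>, since there are no
  paths of degree \<open>-1\<close>.\<close>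

definition pdiff :: "'v \<Rightarrow> ('v list \<Rightarrow>\<^sub>0 real) \<Rightarrow> 'v list \<Rightarrow>\<^sub>0 real" where
  "pdiff v = lin_extend (\<lambda>p. if length p \<le> 1 then 0 else
     (\<Sum>i<length p. (-1) ^ i *\<^sub>R (if p ! i = v
        then Poly_Mapping.single (take i p @ drop (Suc i) p) 1 else 0)))"

text \<open>The operator \<open>dv\<close>; \<open>dvert_adjoint\<close> below shows that it is the adjoint of \<open>\<partial>/\<partial>v\<close>. Its value
  at the empty list, which is not a path, plays no role.\<close>

definition dvert :: "'v \<Rightarrow> ('v list \<Rightarrow>\<^sub>0 real) \<Rightarrow> 'v list \<Rightarrow>\<^sub>0 real" where
  "dvert v = lin_extend (\<lambda>p. \<Sum>i\<le>length p. (-1) ^ i *\<^sub>R Poly_Mapping.single (take i p @ v # drop i p) 1)"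

text \<open>\<open>Ext\<^sup>k(V)\<close> as a space of operators: the linear combinations of the \<open>k\<close>-fold composites
  \<open>dv\<^sub>1 \<circ> \<dots> \<circ> dv\<^sub>k\<close> of generators. For \<open>k = 0\<close> these are the multiplications by scalars.\<close>

definition Ext :: "'v set \<Rightarrow> nat \<Rightarrow> (('v list \<Rightarrow>\<^sub>0 real) \<Rightarrow> 'v list \<Rightarrow>\<^sub>0 real) set" where
  "Ext V k = {\<omega>. \<exists>W c. finite W \<and> W \<subseteq> {vs. set vs \<subseteq> V \<and> length vs = k} \<and>
     \<omega> = (\<lambda>x. \<Sum>vs\<in>W. c vs *\<^sub>R foldr dvert vs x)}"


section \<open>Hypergraphs\<close>

definition hyperedges :: "'v::linorder set \<Rightarrow> 'v list set" where
  "hyperedges V = {p. p \<noteq> [] \<and> set p \<subseteq> V \<and> sorted_wrt (<) p}"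

definition independent_hypergraph :: "'v::linorder set \<Rightarrow> 'v list set \<Rightarrow> bool" where
  "independent_hypergraph V L \<longleftrightarrow> L \<subseteq> hyperedges V \<and>
     (\<forall>\<sigma>\<in>L. \<forall>\<tau>\<in>hyperedges V. set \<sigma> \<subseteq> set \<tau> \<longrightarrow> \<tau> \<in> L)"

definition hchains :: "'v::linorder list set \<Rightarrow> int \<Rightarrow> ('v list \<Rightarrow>\<^sub>0 real) set" where
  "hchains H n = chain_span {\<sigma>\<in>H. int (length \<sigma>) = n + 1}"

definition nonsimplicial :: "'v::linorder list \<Rightarrow> bool" where
  "nonsimplicial p \<longleftrightarrow> (\<exists>i j. i < j \<and> j < length p \<and> (p ! j < p ! i \<or> p ! j = p ! i))"

definition nonsimplicial_space :: "'v::linorder set \<Rightarrow> int \<Rightarrow> ('v list \<Rightarrow>\<^sub>0 real) set" where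
  "nonsimplicial_space V n = chain_span {p \<in> elementary_paths V n. nonsimplicial p}"

definition kill_nonsimplicial :: "('v::linorder list \<Rightarrow>\<^sub>0 real) \<Rightarrow> 'v list \<Rightarrow>\<^sub>0 real" where
  "kill_nonsimplicial = lin_extend (\<lambda>p. if nonsimplicial p then 0 else Poly_Mapping.single p 1)"

text \<open>The quotient of the paths by the non-simplicial ones is represented by the chains of the
  complete hypergraph, see \<open>kill_nonsimplicial_image\<close> and \<open>kill_nonsimplicial_kernel\<close> below.\<close>

definition ext_action ::
  "(('v::linorder list \<Rightarrow>\<^sub>0 real) \<Rightarrow> 'v list \<Rightarrow>\<^sub>0 real) \<Rightarrow> ('v list \<Rightarrow>\<^sub>0 real) \<Rightarrow> 'v list \<Rightarrow>\<^sub>0 real" where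
  "ext_action \<omega> x = kill_nonsimplicial (\<omega> x)"


section \<open>Co-chain complexes\<close>

text \<open>A graded space is a sequence of subspaces of one real vector space. A co-chain complex is a
  graded space together with co-boundary maps, of which only the values on the graded pieces matter.\<close>

definition graded_map :: "(nat \<Rightarrow> 'a::real_vector set) \<Rightarrow> (nat \<Rightarrow> 'b::real_vector set)
    \<Rightarrow> (nat \<Rightarrow> 'a \<Rightarrow> 'b) \<Rightarrow> bool" where
  "graded_map C D f \<longleftrightarrow> (\<forall>n. \<forall>x\<in>C n. f n x \<in> D n \<and>
     (\<forall>y\<in>C n. f n (x + y) = f n x + f n y) \<and> (\<forall>c. f n (c *\<^sub>R x) = c *\<^sub>R f n x))"

definition cochain_complex :: "(nat \<Rightarrow> 'a::real_vector set) \<times> (nat \<Rightarrow> 'a \<Rightarrow> 'a) \<Rightarrow> bool" where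
  "cochain_complex = (\<lambda>(C, d). (\<forall>n. subspace (C n)) \<and> graded_map C (\<lambda>n. C (Suc n)) d \<and>
     (\<forall>n. \<forall>x\<in>C n. d (Suc n) (d n x) = 0))"

definition sub_cochain_complex :: "(nat \<Rightarrow> 'a::real_vector set) \<times> (nat \<Rightarrow> 'a \<Rightarrow> 'a)
    \<Rightarrow> (nat \<Rightarrow> 'a set) \<times> (nat \<Rightarrow> 'a \<Rightarrow> 'a) \<Rightarrow> bool" where
  "sub_cochain_complex = (\<lambda>(C', d') (C, d). cochain_complex (C', d') \<and> cochain_complex (C, d) \<and>
     (\<forall>n. C' n \<subseteq> C n) \<and> (\<forall>n. \<forall>x\<in>C' n. d' n x = d n x))"

definition cochain_map :: "(nat \<Rightarrow> 'a::real_vector set) \<times> (nat \<Rightarrow> 'a \<Rightarrow> 'a)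
    \<Rightarrow> (nat \<Rightarrow> 'b::real_vector set) \<times> (nat \<Rightarrow> 'b \<Rightarrow> 'b) \<Rightarrow> (nat \<Rightarrow> 'a \<Rightarrow> 'b) \<Rightarrow> bool" where
  "cochain_map = (\<lambda>(C, d) (D, e) f. cochain_complex (C, d) \<and> cochain_complex (D, e) \<and>
     graded_map C D f \<and> (\<forall>n. \<forall>x\<in>C n. f (Suc n) (d n x) = e n (f n x)))"

text \<open>The data of \<open>C\<^sup>*(H, \<omega>, m)\<close> for \<open>\<omega>\<close> of degree \<open>2t + 1\<close>: writing \<open>m = \<lambda>(2t + 1) + q\<close> with
  \<open>0 \<le> q \<le> 2t\<close>, the integers \<open>\<lambda>\<close> and \<open>q\<close> are the quotient and remainder of the division of \<open>m\<close>
  by \<open>2t + 1\<close>.\<close>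

definition hcomplex :: "'v::linorder list set \<Rightarrow> nat \<Rightarrow> (('v list \<Rightarrow>\<^sub>0 real) \<Rightarrow> 'v list \<Rightarrow>\<^sub>0 real)
    \<Rightarrow> int \<Rightarrow> (nat \<Rightarrow> ('v list \<Rightarrow>\<^sub>0 real) set) \<times> (nat \<Rightarrow> ('v list \<Rightarrow>\<^sub>0 real) \<Rightarrow> 'v list \<Rightarrow>\<^sub>0 real)" where
  "hcomplex H t \<omega> m = (let N = 2 * int t + 1 in
     (\<lambda>n. hchains H ((int n + m div N) * N + m mod N), \<lambda>n. ext_action \<omega>))"


section \<open>Consistency of the definitions\<close>

lemma lookup_scaleR_real [simp]: "Poly_Mapping.lookup (c *\<^sub>R x) p = c * Poly_Mapping.lookup x p"
  for x :: "'a \<Rightarrow>\<^sub>0 real"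
  unfolding scaleR_poly_mapping_def
  by (subst lookup_Abs_poly_mapping) (auto intro: finite_subset[OF _ finite_lookup[of x]])

lemma lin_extend_superset:
  assumes "finite S" "Poly_Mapping.keys x \<subseteq> S"
  shows "lin_extend f x = (\<Sum>p\<in>S. Poly_Mapping.lookup x p *\<^sub>R f p)"
  unfolding lin_extend_def
  by (rule sum.mono_neutral_left) (use assms in \<open>auto simp: in_keys_iff\<close>)

lemma linear_lin_extend: "linear (lin_extend f)"
proof
  fix x y :: "'a \<Rightarrow>\<^sub>0 real"
  let ?S = "Poly_Mapping.keys x \<union> Poly_Mapping.keys y"
  show "lin_extend f (x + y) = lin_extend f x + lin_extend f y"
    using keys_add[of x y]
    by (simp add: lin_extend_superset[of ?S] lookup_add scaleR_add_left sum.distrib)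
next
  fix c and x :: "'a \<Rightarrow>\<^sub>0 real"
  have "Poly_Mapping.keys (c *\<^sub>R x) \<subseteq> Poly_Mapping.keys x"
    by (auto simp: in_keys_iff)
  then show "lin_extend f (c *\<^sub>R x) = c *\<^sub>R lin_extend f x"
    by (simp add: lin_extend_superset[of "Poly_Mapping.keys x"] scaleR_sum_right)
qed

lemma lin_extend_single [simp]: "lin_extend f (Poly_Mapping.single p 1) = f p"
  by (simp add: lin_extend_def)

lemma span_singles: "x \<in> span ((\<lambda>p. Poly_Mapping.single p 1) ` Poly_Mapping.keys x)"
  for x :: "'a \<Rightarrow>\<^sub>0 real"
proof -
  have "x = (\<Sum>p\<in>Poly_Mapping.keys x. Poly_Mapping.lookup x p *\<^sub>R Poly_Mapping.single p 1)"
    by (rule poly_mapping_eqI)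
      (simp add: lookup_sum lookup_single when_def in_keys_iff if_distrib cong: if_cong)
  also have "\<dots> \<in> span ((\<lambda>p. Poly_Mapping.single p 1) ` Poly_Mapping.keys x)"
    by (intro span_sum span_scale span_base imageI)
  finally show ?thesis .
qed

lemma chain_span_eq: "chain_span P = {x. Poly_Mapping.keys x \<subseteq> P}"
proof
  have "subspace {x :: 'a \<Rightarrow>\<^sub>0 real. Poly_Mapping.keys x \<subseteq> P}"
    by (simp add: subspace_def in_keys_iff subset_iff lookup_add) (metis add.right_neutral)
  then show "chain_span P \<subseteq> {x. Poly_Mapping.keys x \<subseteq> P}"
    unfolding chain_span_def by (intro span_minimal) auto
  show "{x. Poly_Mapping.keys x \<subseteq> P} \<subseteq> chain_span P"
    unfolding chain_span_def using span_singles span_mono[OF image_mono] by fast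
qed

lemma linear_dvert: "linear (dvert v)"
  by (simp add: dvert_def linear_lin_extend)

lemma linear_eq_on_singles:
  fixes f g :: "('a \<Rightarrow>\<^sub>0 real) \<Rightarrow> 'b::real_vector"
  assumes "linear f" "linear g"
    and "\<And>p. p \<in> Poly_Mapping.keys x \<Longrightarrow> f (Poly_Mapping.single p 1) = g (Poly_Mapping.single p 1)"
  shows "f x = g x"
  using assms by (intro linear_eq_on[OF assms(1,2) span_singles[of x]]) auto

lemma dvert_Cons:
  "dvert v (Poly_Mapping.single (u # p) 1) = Poly_Mapping.single (v # u # p) 1
     - lin_extend (\<lambda>p. Poly_Mapping.single (u # p) 1) (dvert v (Poly_Mapping.single p 1))"
proof -
  interpret linear "lin_extend (\<lambda>p. Poly_Mapping.single (u # p) 1)" by (rule linear_lin_extend)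
  show ?thesis
    unfolding dvert_def
    by (simp add: sum.atMost_Suc_shift sum scale sum_negf del: sum.atMost_Suc)
qed

lemma dvert_Cons_lin:
  fixes x :: "'v list \<Rightarrow>\<^sub>0 real"
  defines "C \<equiv> \<lambda>u. lin_extend (\<lambda>p::'v list. Poly_Mapping.single (u # p) 1)"
  shows "dvert v (C u x) = C v (C u x) - C u (dvert v x)"
proof (rule linear_eq_on_singles[where f = "\<lambda>x. dvert v (C u x)"
      and g = "\<lambda>x. C v (C u x) - C u (dvert v x)"])
  have C: "linear (C u)" for u
    by (simp add: C_def linear_lin_extend)
  show "linear (\<lambda>x. dvert v (C u x))"
    using linear_compose[OF C linear_dvert] by (simp add: o_def)
  show "linear (\<lambda>x. C v (C u x) - C u (dvert v x))"
    using linear_compose_sub[OF linear_compose[OF C C] linear_compose[OF linear_dvert C]]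
    by (simp add: o_def)
qed (simp add: dvert_Cons C_def)

lemma dvert_anticommute:
  fixes x :: "'v list \<Rightarrow>\<^sub>0 real"
  shows "dvert u (dvert v x) = - dvert v (dvert u x)"
proof (rule linear_eq_on_singles[where f = "\<lambda>x. dvert u (dvert v x)"
      and g = "\<lambda>x. - dvert v (dvert u x)"])
  show "linear (\<lambda>x::'v list \<Rightarrow>\<^sub>0 real. dvert u (dvert v x))"
    using linear_compose[OF linear_dvert linear_dvert] by (simp add: o_def)
  show "linear (\<lambda>x::'v list \<Rightarrow>\<^sub>0 real. - dvert v (dvert u x))"
    using linear_compose_neg[OF linear_compose[OF linear_dvert linear_dvert]] by (simp add: o_def)
  fix p :: "'v list"
  show "dvert u (dvert v (Poly_Mapping.single p 1)) = - dvert v (dvert u (Poly_Mapping.single p 1))"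
  proof (induction p)
    case Nil
    then show ?case by (simp add: dvert_def)
  next
    case (Cons w p)
    define C where "C = (\<lambda>u. lin_extend (\<lambda>p::'v list. Poly_Mapping.single (u # p) 1))"
    have dC: "dvert v (C u x) = C v (C u x) - C u (dvert v x)" for u v x
      unfolding C_def by (rule dvert_Cons_lin)
    have C: "linear (C u)" for u
      by (simp add: C_def linear_lin_extend)
    have "Poly_Mapping.single (w # p) 1 = C w (Poly_Mapping.single p 1)"
      by (simp add: C_def)
    moreover have "C w (- y) = - C w y" for y
      using C by (rule linear_neg)
    ultimately show ?case
      using Cons
      by (simp add: dC linear_diff[OF C] linear_diff[OF linear_dvert])
  qed
qed

lemma path_inner_superset:
  assumes "finite S" "Poly_Mapping.keys x \<subseteq> S"
  shows "path_inner x y = (\<Sum>p\<in>S. Poly_Mapping.lookup x p * Poly_Mapping.lookup y p)"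
  unfolding path_inner_def
  by (rule sum.mono_neutral_left) (use assms in \<open>auto simp: in_keys_iff\<close>)

lemma path_inner_commute: "path_inner x y = path_inner y x"
  by (simp add: path_inner_superset[of "Poly_Mapping.keys x \<union> Poly_Mapping.keys y"] mult.commute)

lemma linear_path_inner: "linear (\<lambda>y. path_inner x y)"
  by (intro linearI)
    (auto simp: path_inner_def lookup_add distrib_left sum.distrib sum_distrib_left ac_simps)

lemma linear_path_inner_left: "linear (\<lambda>x. path_inner x y)"
  using linear_path_inner[of y] by (simp add: path_inner_commute)

lemma insert_eq_iff_remove:
  assumes "length q = Suc (length p)" "i \<le> length p"
  shows "take i p @ v # drop i p = q \<longleftrightarrow> q ! i = v \<and> take i q @ drop (Suc i) q = p"
proof
  assume "take i p @ v # drop i p = q"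
  then show "q ! i = v \<and> take i q @ drop (Suc i) q = p"
    using assms by (auto simp: nth_append)
next
  assume r: "q ! i = v \<and> take i q @ drop (Suc i) q = p"
  have "take i (take i q @ drop (Suc i) q) = take i q" "drop i (take i q @ drop (Suc i) q) = drop (Suc i) q"
    using assms by auto
  with r have "take i p = take i q" "drop i p = drop (Suc i) q"
    by auto
  with r id_take_nth_drop[of i q] assms show "take i p @ v # drop i p = q"
    by simp
qed

lemma path_inner_single: "path_inner (Poly_Mapping.single p 1) y = Poly_Mapping.lookup y p"
  by (simp add: path_inner_def)

lemma dvert_adjoint_single:
  assumes "p \<noteq> []"
  shows "path_inner (dvert v (Poly_Mapping.single p 1)) (Poly_Mapping.single q 1) =
    path_inner (Poly_Mapping.single p 1) (pdiff v (Poly_Mapping.single q 1))"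
proof (cases "length q = Suc (length p)")
  case True
  then have "length q > 1"
    using assms by simp
  with True show ?thesis
    unfolding path_inner_commute[of _ "Poly_Mapping.single q 1"] path_inner_single
    by (auto simp: dvert_def pdiff_def lookup_sum lookup_single when_def lessThan_Suc_atMost
        insert_eq_iff_remove intro!: sum.cong)
next
  case False
  then have "take i p @ v # drop i p \<noteq> q" if "i \<le> length p" for i
    using that by auto
  moreover have "take i q @ drop (Suc i) q \<noteq> p" if "i < length q" for i
    using that False by auto
  ultimately show ?thesis
    unfolding path_inner_commute[of _ "Poly_Mapping.single q 1"] path_inner_single
    by (auto simp: dvert_def pdiff_def lookup_sum lookup_single when_def intro!: sum.neutral)
qed

lemma dvert_adjoint:
  assumes "[] \<notin> Poly_Mapping.keys x"
  shows "path_inner (dvert v x) y = path_inner x (pdiff v y)"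
proof (rule linear_eq_on_singles[where f = "\<lambda>x. path_inner (dvert v x) y"])
  show "linear (\<lambda>x. path_inner (dvert v x) y)"
    using linear_compose[OF linear_dvert linear_path_inner_left] by (simp add: o_def)
  show "linear (\<lambda>x. path_inner x (pdiff v y))"
    by (rule linear_path_inner_left)
  fix p assume "p \<in> Poly_Mapping.keys x"
  with assms have p: "p \<noteq> []" by auto
  show "path_inner (dvert v (Poly_Mapping.single p 1)) y = path_inner (Poly_Mapping.single p 1) (pdiff v y)"
  proof (rule linear_eq_on_singles[where g = "\<lambda>y. path_inner (Poly_Mapping.single p 1) (pdiff v y)"])
    have "linear (pdiff v)"
      by (simp add: pdiff_def linear_lin_extend)
    from linear_compose[OF this linear_path_inner]
    show "linear (\<lambda>y. path_inner (Poly_Mapping.single p 1) (pdiff v y))"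
      by (simp add: o_def)
  qed (use dvert_adjoint_single p in \<open>auto simp: linear_path_inner\<close>)
qed

lemma nonsimplicial_iff: "nonsimplicial p \<longleftrightarrow> \<not> sorted_wrt (<) p"
proof -
  have "nonsimplicial p \<longleftrightarrow> \<not> (\<forall>i j. i < j \<longrightarrow> j < length p \<longrightarrow> p ! i < p ! j)"
    unfolding nonsimplicial_def by (auto simp: not_less le_less)
  then show ?thesis
    by (simp add: sorted_wrt_iff_nth_less)
qed

lemma kill_nonsimplicial_alt:
  "kill_nonsimplicial = lin_extend (\<lambda>p. if sorted_wrt (<) p then Poly_Mapping.single p 1 else 0)"
  unfolding kill_nonsimplicial_def by (intro arg_cong[where f = lin_extend] ext) (simp add: nonsimplicial_iff)

lemma linear_kill_nonsimplicial: "linear kill_nonsimplicial"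
  by (simp add: kill_nonsimplicial_alt linear_lin_extend)

lemma lookup_kill_nonsimplicial:
  "Poly_Mapping.lookup (kill_nonsimplicial x) p =
     (if sorted_wrt (<) p then Poly_Mapping.lookup x p else 0)"
proof -
  have "Poly_Mapping.lookup (kill_nonsimplicial x) p = (\<Sum>q\<in>Poly_Mapping.keys x.
      if q = p then (if sorted_wrt (<) p then Poly_Mapping.lookup x p else 0) else 0)"
    unfolding kill_nonsimplicial_alt lin_extend_def lookup_sum
    by (intro sum.cong) (auto simp: lookup_single when_def)
  then show ?thesis
    by (simp add: in_keys_iff)
qed

lemma kill_nonsimplicial_image:
  "kill_nonsimplicial ` path_space V n = hchains (hyperedges V) n"
proof -
  have sub: "hchains (hyperedges V) n \<subseteq> path_space V n"
    by (auto simp: hchains_def path_space_def chain_span_eq hyperedges_def elementary_paths_def)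
  have "kill_nonsimplicial x \<in> hchains (hyperedges V) n" if "x \<in> path_space V n" for x
    using that unfolding path_space_def hchains_def chain_span_eq hyperedges_def elementary_paths_def
    by (auto simp: in_keys_iff lookup_kill_nonsimplicial subset_iff split: if_splits)
  moreover have "kill_nonsimplicial x = x" if "x \<in> hchains (hyperedges V) n" for x
    using that unfolding hchains_def chain_span_eq hyperedges_def
    by (intro poly_mapping_eqI) (auto simp: in_keys_iff lookup_kill_nonsimplicial subset_iff)
  ultimately show ?thesis
    using sub by force
qed

lemma kill_nonsimplicial_kernel:
  assumes "x \<in> path_space V n"
  shows "kill_nonsimplicial x = 0 \<longleftrightarrow> x \<in> nonsimplicial_space V n"
  using assms
  unfolding path_space_def nonsimplicial_space_def chain_span_eq poly_mapping_eq_iff fun_eq_iff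
  by (auto simp: in_keys_iff lookup_kill_nonsimplicial nonsimplicial_iff subset_iff)

lemma kill_dvert_kill:
  "kill_nonsimplicial (dvert v (kill_nonsimplicial x)) = kill_nonsimplicial (dvert v x)"
proof (rule linear_eq_on_singles[where f = "\<lambda>x. kill_nonsimplicial (dvert v (kill_nonsimplicial x))"])
  note lin = linear_compose[OF linear_dvert linear_kill_nonsimplicial]
  show "linear (\<lambda>x. kill_nonsimplicial (dvert v x))"
    using lin by (simp add: o_def)
  show "linear (\<lambda>x. kill_nonsimplicial (dvert v (kill_nonsimplicial x)))"
    using linear_compose[OF linear_kill_nonsimplicial lin] by (simp add: o_def)
  fix p :: "'a list"
  show "kill_nonsimplicial (dvert v (kill_nonsimplicial (Poly_Mapping.single p 1))) =
    kill_nonsimplicial (dvert v (Poly_Mapping.single p 1))"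
  proof (cases "sorted_wrt (<) p")
    case True
    then show ?thesis by (simp add: kill_nonsimplicial_alt)
  next
    case False
    have "\<not> sorted_wrt (<) (take i p @ v # drop i p)" for i
    proof
      assume "sorted_wrt (<) (take i p @ v # drop i p)"
      then have "sorted_wrt (<) (take i p @ drop i p)"
        unfolding sorted_wrt_append by auto
      with False show False by simp
    qed
    then have "kill_nonsimplicial (dvert v (Poly_Mapping.single p 1)) = 0"
      by (simp add: dvert_def linear_sum[OF linear_kill_nonsimplicial]
          linear_scale[OF linear_kill_nonsimplicial]) (simp add: kill_nonsimplicial_alt)
    moreover have "kill_nonsimplicial (Poly_Mapping.single p 1) = 0"
      using False by (simp add: kill_nonsimplicial_alt)
    ultimately show ?thesis
      by (simp add: linear_0[OF linear_dvert] linear_0[OF linear_kill_nonsimplicial])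
  qed
qed

lemma ext_action_mod_nonsimplicial:
  assumes "\<omega> \<in> Ext V k"
  shows "ext_action \<omega> (kill_nonsimplicial x) = kill_nonsimplicial (\<omega> x)"
proof -
  have "kill_nonsimplicial (foldr dvert vs (kill_nonsimplicial x)) =
      kill_nonsimplicial (foldr dvert vs x)" for vs
  proof (induction vs)
    case Nil
    then show ?case by (simp add: poly_mapping_eq_iff fun_eq_iff lookup_kill_nonsimplicial)
  next
    case (Cons v vs)
    have "kill_nonsimplicial (dvert v (foldr dvert vs (kill_nonsimplicial x))) =
        kill_nonsimplicial (dvert v (kill_nonsimplicial (foldr dvert vs x)))"
      using Cons by (subst kill_dvert_kill[symmetric]) simp
    then show ?case
      by (simp add: kill_dvert_kill)
  qed
  with assms show ?thesis
    by (auto simp: Ext_def ext_action_def linear_sum[OF linear_kill_nonsimplicial]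
        linear_scale[OF linear_kill_nonsimplicial])
qed

end

theory Submission
  imports Defs
begin

text \<open>The generators \<open>dv\<close> anticommute, so operators of degrees \<open>k\<close> and \<open>l\<close> commute up to the sign
  \<open>(-1)\<^sup>k\<^sup>l\<close>; hence odd operators square to zero and even operators commute with all others. Since
  \<open>dv\<close> only inserts vertices into a path, the increasing paths occurring in the image of a hyperedge
  of \<open>L\<close> contain it, and therefore lie in \<open>L\<close>. Projecting away the non-simplicial paths respects
  composition, so both facts pass to the action on chains.\<close>

section \<open>Supports of images under the operators\<close>

lemma keys_dvert:
  assumes "q \<in> Poly_Mapping.keys (dvert v x)"
  obtains p where "p \<in> Poly_Mapping.keys x" "length q = Suc (length p)" "set q = insert v (set p)"
proof -
  \<comment> \<open>If no insertion of \<open>v\<close> into a path of \<open>x\<close> produced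
    \<open>q\<close>, every term contributing to the coefficient of \<open>q\<close> would
    vanish.\<close>
  have "\<exists>p\<in>Poly_Mapping.keys x. \<exists>i\<le>length p. take i p @ v # drop i p = q"
  proof (rule ccontr)
    assume "\<not> ?thesis"
    then have "Poly_Mapping.lookup (dvert v x) q = 0"
      unfolding dvert_def lin_extend_def lookup_sum
      by (intro sum.neutral) (simp add: lookup_sum lookup_single when_def)
    with assms show False
      by (simp add: in_keys_iff)
  qed
  then obtain p i where "p \<in> Poly_Mapping.keys x" and q: "i \<le> length p" "q = take i p @ v # drop i p"
    by metis
  moreover have "set (take i p) \<union> set (drop i p) = set p"
    by (metis append_take_drop_id set_append)
  ultimately show ?thesis
    using that[of p] by auto
qed

lemma keys_foldr_dvert:
  assumes "q \<in> Poly_Mapping.keys (foldr dvert vs x)"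
  shows "\<exists>p\<in>Poly_Mapping.keys x. length q = length vs + length p \<and> set q = set vs \<union> set p"
  using assms
proof (induction vs arbitrary: q)
  case (Cons v vs)
  then obtain r where "r \<in> Poly_Mapping.keys (foldr dvert vs x)"
    and "length q = Suc (length r)" "set q = insert v (set r)"
    by (auto elim: keys_dvert)
  with Cons.IH[of r] show ?case
    by auto
qed auto

text \<open>A nonzero coefficient of \<open>q\<close> in the linear combination forces a nonzero one
  in some composite. The lower bound on \<open>set q\<close> serves the upward closure of
  \<open>L\<close>; the upper bound keeps \<open>q\<close> inside \<open>V\<close>.\<close>

lemma keys_Ext:
  assumes "\<omega> \<in> Ext V k" "q \<in> Poly_Mapping.keys (\<omega> x)"
  obtains p where "p \<in> Poly_Mapping.keys x" "length q = k + length p" "set p \<subseteq> set q"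
    "set q \<subseteq> V \<union> set p"
proof -
  obtain W c where "finite W" and W: "W \<subseteq> {vs. set vs \<subseteq> V \<and> length vs = k}"
    and \<omega>: "\<omega> = (\<lambda>x. \<Sum>vs\<in>W. c vs *\<^sub>R foldr dvert vs x)"
    using assms(1) unfolding Ext_def by blast
  have "(\<Sum>vs\<in>W. c vs * Poly_Mapping.lookup (foldr dvert vs x) q) \<noteq> 0"
    using assms(2) by (simp add: \<omega> in_keys_iff lookup_sum)
  then obtain vs where "vs \<in> W" "q \<in> Poly_Mapping.keys (foldr dvert vs x)"
    by (metis (no_types, lifting) in_keys_iff mult_zero_right sum.neutral)
  with keys_foldr_dvert[of q vs x] W that show ?thesis
    by blast
qed

section \<open>Commutation up to sign, on paths and then on chains\<close>

lemma linear_foldr_dvert: "linear (foldr dvert vs)"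
proof (induction vs)
  case Nil
  then show ?case using linear_id by (simp add: id_def)
next
  case (Cons v vs)
  from linear_compose[OF this linear_dvert] show ?case
    by (simp add: o_def)
qed

lemma linear_Ext:
  assumes "\<omega> \<in> Ext V k"
  shows "linear \<omega>"
  using assms unfolding Ext_def
  by (auto intro!: linear_compose_sum linear_compose_scale_right linear_foldr_dvert)

text \<open>Each generator that \<open>dvert u\<close> passes contributes one factor -1.\<close>

lemma dvert_foldr_dvert: "dvert u (foldr dvert vs x) = (-1) ^ length vs *\<^sub>R foldr dvert vs (dvert u x)"
proof (induction vs)
  case (Cons v vs)
  then show ?case
    using dvert_anticommute[of u v "foldr dvert vs x"]
    by (simp add: linear_scale[OF linear_dvert])
qed simp

lemma foldr_dvert_commute:
  "foldr dvert us (foldr dvert vs x)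
    = (-1) ^ (length us * length vs) *\<^sub>R foldr dvert vs (foldr dvert us x)"
proof (induction us)
  case (Cons u us)
  then show ?case
    by (simp add: linear_scale[OF linear_dvert] dvert_foldr_dvert power_add mult.commute)
qed simp

lemma Ext_commute:
  assumes "\<omega> \<in> Ext V k" "\<mu> \<in> Ext V l"
  shows "\<omega> (\<mu> x) = (-1) ^ (k * l) *\<^sub>R \<mu> (\<omega> x)"
proof -
  obtain W c where W: "W \<subseteq> {vs. set vs \<subseteq> V \<and> length vs = k}"
    and \<omega>: "\<omega> = (\<lambda>x. \<Sum>vs\<in>W. c vs *\<^sub>R foldr dvert vs x)"
    using assms(1) unfolding Ext_def by blast
  obtain U d where U: "U \<subseteq> {us. set us \<subseteq> V \<and> length us = l}"
    and \<mu>: "\<mu> = (\<lambda>x. \<Sum>us\<in>U. d us *\<^sub>R foldr dvert us x)"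
    using assms(2) unfolding Ext_def by blast
  note lin = linear_sum[OF linear_foldr_dvert] linear_scale[OF linear_foldr_dvert]
  have "\<omega> (\<mu> x) = (\<Sum>vs\<in>W. \<Sum>us\<in>U. (c vs * d us) *\<^sub>R foldr dvert vs (foldr dvert us x))"
    by (simp add: \<omega> \<mu> lin scaleR_sum_right)
  also have "\<dots> = (\<Sum>vs\<in>W. \<Sum>us\<in>U.
      (-1) ^ (k * l) *\<^sub>R (d us * c vs) *\<^sub>R foldr dvert us (foldr dvert vs x))"
  proof (intro sum.cong refl)
    fix vs us assume "vs \<in> W" "us \<in> U"
    with W U have "length vs = k" "length us = l" by auto
    then show "(c vs * d us) *\<^sub>R foldr dvert vs (foldr dvert us x) =
        (-1) ^ (k * l) *\<^sub>R (d us * c vs) *\<^sub>R foldr dvert us (foldr dvert vs x)"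
      by (simp add: foldr_dvert_commute[of vs] mult.commute mult.left_commute)
  qed
  also have "\<dots> = (-1) ^ (k * l) *\<^sub>R \<mu> (\<omega> x)"
    \<comment> \<open>Summing over \<open>U\<close> on the outside matches the expansion of
      \<open>\<mu> (\<omega> x)\<close>.\<close>
    by (subst sum.swap) (simp add: \<omega> \<mu> lin scaleR_sum_right)
  finally show ?thesis .
qed

lemma ext_action_commute:
  assumes "\<omega> \<in> Ext V k" "\<mu> \<in> Ext V l"
  shows "ext_action \<omega> (ext_action \<mu> x) = (-1) ^ (k * l) *\<^sub>R ext_action \<mu> (ext_action \<omega> x)"
proof -
  have "ext_action \<omega> (ext_action \<mu> x) = kill_nonsimplicial (\<omega> (\<mu> x))"
    using ext_action_mod_nonsimplicial[OF assms(1)] by (simp add: ext_action_def)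
  also have "\<dots> = (-1) ^ (k * l) *\<^sub>R kill_nonsimplicial (\<mu> (\<omega> x))"
    by (simp add: Ext_commute[OF assms] linear_scale[OF linear_kill_nonsimplicial])
  also have "kill_nonsimplicial (\<mu> (\<omega> x)) = ext_action \<mu> (ext_action \<omega> x)"
    using ext_action_mod_nonsimplicial[OF assms(2)] by (simp add: ext_action_def)
  finally show ?thesis .
qed

text \<open>Commuting \<open>\<omega>\<close> with itself gives the sign -1, as \<open>k * k\<close>
  is odd. The square thus equals its own negative, and 2 is invertible in the reals.\<close>

lemma ext_action_odd_square:
  assumes "\<omega> \<in> Ext V k" "odd k"
  shows "ext_action \<omega> (ext_action \<omega> x) = 0"
  using ext_action_commute[OF assms(1,1), of x] assms(2) by (simp add: eq_neg_iff_add_eq_0 scaleR_2[symmetric])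

lemma linear_ext_action:
  assumes "\<omega> \<in> Ext V k"
  shows "linear (ext_action \<omega>)"
proof -
  have "ext_action \<omega> = kill_nonsimplicial \<circ> \<omega>"
    by (auto simp: ext_action_def)
  then show ?thesis
    by (simp add: linear_compose[OF linear_Ext[OF assms] linear_kill_nonsimplicial])
qed

section \<open>Chains of an independent hypergraph and their complexes\<close>

lemma subspace_hchains: "subspace (hchains H n)"
  by (simp add: hchains_def chain_span_def)

lemma hchains_mono: "H \<subseteq> H' \<Longrightarrow> hchains H n \<subseteq> hchains H' n"
  by (auto simp: hchains_def chain_span_eq)

text \<open>Allows the ambient complex to be treated as a case of the complex of
  \<open>L\<close>.\<close>

lemma independent_hyperedges: "independent_hypergraph V (hyperedges V)"
  by (simp add: independent_hypergraph_def)

lemma ext_action_hchains: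
  assumes L: "independent_hypergraph V L" and "\<omega> \<in> Ext V k" and x: "x \<in> hchains L n"
  shows "ext_action \<omega> x \<in> hchains L (n + int k)"
proof -
  have "q \<in> L \<and> int (length q) = n + int k + 1"
    if q: "q \<in> Poly_Mapping.keys (ext_action \<omega> x)" for q
  proof -
    from q have sorted: "sorted_wrt (<) q" and "q \<in> Poly_Mapping.keys (\<omega> x)"
      by (auto simp: ext_action_def in_keys_iff lookup_kill_nonsimplicial split: if_splits)
    with keys_Ext[OF assms(2)] obtain p where p: "p \<in> Poly_Mapping.keys x" "length q = k + length p"
      "set p \<subseteq> set q" "set q \<subseteq> V \<union> set p"
      by metis
    from x p(1) have "p \<in> L" "int (length p) = n + 1"
      by (auto simp: hchains_def chain_span_eq)
    \<comment> \<open>A path in the support of \<open>x\<close> is a nonempty hyperedge on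
      \<open>V\<close>, so \<open>q\<close>, which contains it, is nonempty and has its vertices in
      \<open>V\<close>. Being increasing, \<open>q\<close> is a hyperedge, and independence puts it
      in \<open>L\<close>.\<close>
    moreover from \<open>p \<in> L\<close> L have "p \<noteq> []" "set p \<subseteq> V"
      by (auto simp: independent_hypergraph_def hyperedges_def)
    with p sorted have "q \<in> hyperedges V"
      by (auto simp: hyperedges_def)
    ultimately show ?thesis
      using L p by (auto simp: independent_hypergraph_def)
  qed
  then show ?thesis
    by (auto simp: hchains_def chain_span_eq)
qed

text \<open>The free degree functions \<open>d\<close> and \<open>e\<close> cover both the
  co-boundary, with shift \<open>2 * t + 1\<close>, and the map \<open>\<mu>\<close>, with shift
  \<open>2 * s\<close>.\<close>

lemma graded_map_ext_action:
  assumes "independent_hypergraph V L" "\<omega> \<in> Ext V k" "\<And>n. e n = d n + int k"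
  shows "graded_map (\<lambda>n. hchains L (d n)) (\<lambda>n. hchains L (e n)) (\<lambda>n. ext_action \<omega>)"
  using ext_action_hchains[OF assms(1,2)] linear_ext_action[OF assms(2)]
  by (simp add: graded_map_def assms(3) linear_add linear_scale)

text \<open>Quotient and remainder recombine to \<open>m\<close>. In this form, replacing
  \<open>m\<close> by \<open>m + 2 * int s\<close> shifts every degree by \<open>2 * s\<close>, even
  if the remainder wraps around.\<close>

lemma hcomplex_alt:
  "hcomplex H t \<omega> m = (\<lambda>n. hchains H (int n * (2 * int t + 1) + m), \<lambda>n. ext_action \<omega>)"
  by (simp add: hcomplex_def Let_def distrib_right add.assoc)

lemma cochain_complex_hcomplex:
  assumes "independent_hypergraph V L" "\<omega> \<in> Ext V (2 * t + 1)"
  shows "cochain_complex (hcomplex L t \<omega> m)"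
  using graded_map_ext_action[OF assms, where d = "\<lambda>n. int n * (2 * int t + 1) + m"
      and e = "\<lambda>n. int (Suc n) * (2 * int t + 1) + m"] ext_action_odd_square[OF assms(2)]
  by (simp add: cochain_complex_def hcomplex_alt subspace_hchains algebra_simps)

lemma sub_cochain_complex_hcomplex:
  assumes "independent_hypergraph V L" "\<omega> \<in> Ext V (2 * t + 1)"
  shows "sub_cochain_complex (hcomplex L t \<omega> m) (hcomplex (hyperedges V) t \<omega> m)"
proof -
  have "hchains L n \<subseteq> hchains (hyperedges V) n" for n
    using assms(1) by (intro hchains_mono) (simp add: independent_hypergraph_def)
  with cochain_complex_hcomplex[OF assms, of m]
    cochain_complex_hcomplex[OF independent_hyperedges assms(2), of m]
  show ?thesis
    by (simp add: sub_cochain_complex_def hcomplex_alt)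
qed

lemma cochain_map_hcomplex:
  assumes "independent_hypergraph V L" "\<omega> \<in> Ext V (2 * t + 1)" "\<mu> \<in> Ext V (2 * s)"
  shows "cochain_map (hcomplex L t \<omega> m) (hcomplex L t \<omega> (m + 2 * int s)) (\<lambda>n. ext_action \<mu>)"
proof -
  have "ext_action \<mu> (ext_action \<omega> x) = ext_action \<omega> (ext_action \<mu> x)" for x
    using ext_action_commute[OF assms(3,2), of x] by simp
  moreover have "graded_map (\<lambda>n. hchains L (int n * (2 * int t + 1) + m))
      (\<lambda>n. hchains L (int n * (2 * int t + 1) + (m + 2 * int s))) (\<lambda>n. ext_action \<mu>)"
    by (rule graded_map_ext_action[OF assms(1,3)]) simp
  ultimately show ?thesis
    using cochain_complex_hcomplex[OF assms(1,2)]
    by (simp add: cochain_map_def hcomplex_alt)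
qed

theorem theorem4p7:
  fixes V :: "'v::linorder set" and L :: "'v list set"
    and t s :: nat and m lam q :: int
  assumes "finite V"
    and "independent_hypergraph V L"
    and "m = lam * (2 * int t + 1) + q"
    and "0 \<le> q" and "q \<le> 2 * int t"
  shows "(\<forall>\<omega>\<in>Ext V (2 * t + 1).
        sub_cochain_complex
          (\<lambda>n. hchains L ((int n + lam) * (2 * int t + 1) + q), \<lambda>n. ext_action \<omega>)
          (hcomplex (hyperedges V) t \<omega> m)
        \<and> hcomplex L t \<omega> m
          = (\<lambda>n. hchains L ((int n + lam) * (2 * int t + 1) + q), \<lambda>n. ext_action \<omega>))
    \<and> (\<forall>\<omega>\<in>Ext V (2 * t + 1). \<forall>\<mu>\<in>Ext V (2 * s).
        cochain_map (hcomplex L t \<omega> m) (hcomplex L t \<omega> (m + 2 * int s)) (\<lambda>n. ext_action \<mu>))"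
proof -
  \<comment> \<open>Both descriptions have \<open>int n * (2 * int t + 1) + m\<close> as the degree
    of the term with index \<open>n\<close>.\<close>
  have eq: "hcomplex L t \<omega> m
      = (\<lambda>n. hchains L ((int n + lam) * (2 * int t + 1) + q), \<lambda>n. ext_action \<omega>)" for \<omega>
    by (simp add: hcomplex_alt assms(3) distrib_right add.assoc)
  show ?thesis
    using sub_cochain_complex_hcomplex[OF assms(2), of _ t m] cochain_map_hcomplex[OF assms(2)]
    unfolding eq[symmetric] by blast
qed

end
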